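(* Let $K=\{1,\dots,k\}$ be a nonempty finite index set and let $f_i,g_i:\mathcal{X}\to\mathbb{R}$, $i\in K$, be L$^\natural$-convex functions on a common discrete hyperrectangle $\mathcal{X}\subseteq\mathbb{Z}^n$. Let $$\mathcal{Q}'=\{(\boldsymbol\eta,\mathbf{w},\mathbf{x})\in\mathbb{R}^{2k}\times\mathcal{X}:\ \eta_i\ge g_i(\mathbf{x})\ \forall i\in K,\ w_i\ge f_i(\mathbf{x})\ \forall i\in K,\ \eta_i-w_i=\eta_{i'}-w_{i'}\ \forall i,i'\in K\},$$ $$\mathcal{CQ}'=\{(\boldsymbol\eta,\mathbf{w},\mathbf{x})\in\mathbb{R}^{2k}\times\overline{\mathcal{X}}:\ (\eta_i,\mathbf{x})\in\operatorname{conv}(\mathcal{P}^{g_i}_{\mathcal{X}})\ \forall i\in K,\ (w_i,\mathbf{x})\in\operatorname{conv}(\mathcal{P}^{f_i}_{\mathcal{X}})\ \forall i\in K,\ \eta_i-w_i=\eta_{i'}-w_{i'}\ \forall i,i'\in K\}.$$ If there exists $h:\mathcal{X}\to\mathbb{R}$ with $h(\mathbf{x})=g_i(\mathbf{x})-f_i(\mathbf{x})$ for all $\mathbf{x}\in\mathcal{X}$ and all $i\in K$, then $\operatorname{conv}(\mathcal{Q}')=\mathcal{CQ}'$.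
   Context: $N=\{1,\dots,n\}$. A discrete hyperrectangle is $\mathcal{X}=\{\mathbf{x}\in\mathbb{Z}^n:\ell_i\le x_i\le u_i\ \forall i\in N\}$ with $\ell_i\in\mathbb{Z}\cup\{-\infty\}$, $u_i\in\mathbb{Z}\cup\{+\infty\}$; $\overline{\mathcal{X}}=\{\mathbf{x}\in\mathbb{R}^n:\ell_i\le x_i\le u_i\ \forall i\in N\}$. $f:\mathcal{X}\to\mathbb{R}$ is L$^\natural$-convex if $f(\mathbf{x})+f(\mathbf{y})\ge f(\lceil(\mathbf{x}+\mathbf{y})/2\rceil)+f(\lfloor(\mathbf{x}+\mathbf{y})/2\rfloor)$ for all $\mathbf{x},\mathbf{y}\in\mathcal{X}$ (component-wise rounding). $\mathcal{P}^{f}_{\mathcal{X}}=\{(w,\mathbf{x})\in\mathbb{R}\times\mathcal{X}:w\ge f(\mathbf{x})\}$. *)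

theory Defs
  imports "HOL-Analysis.Analysis"
begin

text \<open>
  Integer points are real vectors with integer coordinates, so that a discrete
  hyperrectangle is literally a subset of its continuous counterpart. The bounds are
  extended reals; that a lower bound lies in the integers extended by \<open>-\<infinity>\<close> (dually for
  upper bounds) is a separate hypothesis. A function on a discrete hyperrectangle is a
  total function of which only the values on that set are ever used.
\<close>

definition int_or_minf :: "ereal set" where
  "int_or_minf = range (\<lambda>m::int. ereal (real_of_int m)) \<union> {-\<infinity>}"

definition int_or_pinf :: "ereal set" where
  "int_or_pinf = range (\<lambda>m::int. ereal (real_of_int m)) \<union> {\<infinity>}"

definition hyperrect :: "('n::finite \<Rightarrow> ereal) \<Rightarrow> ('n \<Rightarrow> ereal) \<Rightarrow> (real ^ 'n) set" where
  "hyperrect l u = {x. \<forall>i. l i \<le> ereal (x $ i) \<and> ereal (x $ i) \<le> u i}"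

definition discrete_hyperrect :: "('n::finite \<Rightarrow> ereal) \<Rightarrow> ('n \<Rightarrow> ereal) \<Rightarrow> (real ^ 'n) set" where
  "discrete_hyperrect l u =
     {x. (\<forall>i. x $ i \<in> \<int>) \<and> (\<forall>i. l i \<le> ereal (x $ i) \<and> ereal (x $ i) \<le> u i)}"

definition vec_ceiling :: "real ^ 'n \<Rightarrow> real ^ 'n" where
  "vec_ceiling x = (\<chi> i. real_of_int \<lceil>x $ i\<rceil>)"

definition vec_floor :: "real ^ 'n \<Rightarrow> real ^ 'n" where
  "vec_floor x = (\<chi> i. real_of_int \<lfloor>x $ i\<rfloor>)"

text \<open>
  The definition is meant for discrete hyperrectangles, which contain both rounded
  midpoints of any two of their points.
\<close>

definition L_natural_convex_on :: "(real ^ 'n::finite) set \<Rightarrow> (real ^ 'n \<Rightarrow> real) \<Rightarrow> bool" where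
  "L_natural_convex_on X f \<longleftrightarrow>
     (\<forall>x\<in>X. \<forall>y\<in>X.
        f x + f y \<ge> f (vec_ceiling ((1/2) *\<^sub>R (x + y))) + f (vec_floor ((1/2) *\<^sub>R (x + y))))"

text \<open>The library's \<open>epigraph\<close> with the two components swapped.\<close>

definition epi :: "(real ^ 'n::finite) set \<Rightarrow> (real ^ 'n \<Rightarrow> real) \<Rightarrow> (real \<times> (real ^ 'n)) set" where
  "epi X f = {(w, x). x \<in> X \<and> w \<ge> f x}"

definition Q' ::
  "(real ^ 'n::finite) set \<Rightarrow> ('k::finite \<Rightarrow> real ^ 'n \<Rightarrow> real) \<Rightarrow> ('k \<Rightarrow> real ^ 'n \<Rightarrow> real) \<Rightarrow>
   ((real ^ 'k) \<times> (real ^ 'k) \<times> (real ^ 'n)) set" where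
  "Q' X f g =
     {(\<eta>, w, x). x \<in> X \<and>
        (\<forall>i. \<eta> $ i \<ge> g i x) \<and>
        (\<forall>i. w $ i \<ge> f i x) \<and>
        (\<forall>i i'. \<eta> $ i - w $ i = \<eta> $ i' - w $ i')}"

definition CQ' ::
  "(real ^ 'n::finite) set \<Rightarrow> (real ^ 'n) set \<Rightarrow>
   ('k::finite \<Rightarrow> real ^ 'n \<Rightarrow> real) \<Rightarrow> ('k \<Rightarrow> real ^ 'n \<Rightarrow> real) \<Rightarrow>
   ((real ^ 'k) \<times> (real ^ 'k) \<times> (real ^ 'n)) set" where
  "CQ' X Xbar f g =
     {(\<eta>, w, x). x \<in> Xbar \<and>
        (\<forall>i. (\<eta> $ i, x) \<in> convex hull (epi X (g i))) \<and>
        (\<forall>i. (w $ i, x) \<in> convex hull (epi X (f i))) \<and>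
        (\<forall>i i'. \<eta> $ i - w $ i = \<eta> $ i' - w $ i')}"

end

theory Submission
  imports Defs
begin

text \<open>
  For every point \<open>x\<close> of the continuous hyperrectangle, the Freudenthal simplex containing \<open>x\<close>
  gives weights \<open>c\<^sub>j\<close> and lattice points \<open>v\<^sub>j\<close>, depending on \<open>x\<close> only, such that the convex
  envelope of \<^emph>\<open>every\<close> L-natural-convex function \<open>f\<close> has the value \<open>\<Sum>j. c\<^sub>j f(v\<^sub>j)\<close> at \<open>x\<close>: the
  affine function that interpolates \<open>f\<close> on the simplex minorizes \<open>f\<close>, since midpoint convexity
  against the bottom and the top vertex pulls any lattice point into the unit cube, where it is
  submodularity. Given a point of \<open>CQ'\<close>, let \<open>s\<close> and \<open>t\<close> be the slacks of \<open>w\<close> and \<open>\<eta>\<close> over the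
  envelopes at \<open>x\<close>. As \<open>g\<^sub>i - f\<^sub>i\<close> does not depend on \<open>i\<close>, neither does \<open>t\<^sub>i - s\<^sub>i\<close>, and the point
  is the combination with weights \<open>c\<^sub>j\<close> of the points \<open>(g(v\<^sub>j) + t, f(v\<^sub>j) + s, v\<^sub>j)\<close> of \<open>Q'\<close>.
\<close>

section \<open>Midpoint convexity on integer vectors\<close>

definition ind :: "'a set \<Rightarrow> 'a \<Rightarrow> int" where
  "ind S i = (if i \<in> S then 1 else 0)"

lemma ind_empty [simp]: "ind {} = (\<lambda>_. 0)"
  by (simp add: ind_def fun_eq_iff)

text \<open>The two quotients are the ceiling and the floor of \<open>(a + b) / 2\<close>, kept in
  integer arithmetic.\<close>

definition midpoint_closed :: "('a \<Rightarrow> int) set \<Rightarrow> bool" where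
  "midpoint_closed B \<longleftrightarrow>
     (\<forall>a\<in>B. \<forall>b\<in>B. (\<lambda>i. (a i + b i + 1) div 2) \<in> B \<and> (\<lambda>i. (a i + b i) div 2) \<in> B)"

definition midpoint_convex :: "('a \<Rightarrow> int) set \<Rightarrow> (('a \<Rightarrow> int) \<Rightarrow> real) \<Rightarrow> bool" where
  "midpoint_convex B F \<longleftrightarrow>
     (\<forall>a\<in>B. \<forall>b\<in>B. F (\<lambda>i. (a i + b i + 1) div 2) + F (\<lambda>i. (a i + b i) div 2) \<le> F a + F b)"

lemma midpoint_closedD:
  assumes "midpoint_closed B" "a \<in> B" "b \<in> B"
  shows "(\<lambda>i. (a i + b i + 1) div 2) \<in> B" "(\<lambda>i. (a i + b i) div 2) \<in> B"
  using assms unfolding midpoint_closed_def by blast+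

lemma midpoint_convexD:
  assumes "midpoint_convex B F" "a \<in> B" "b \<in> B"
  shows "F (\<lambda>i. (a i + b i + 1) div 2) + F (\<lambda>i. (a i + b i) div 2) \<le> F a + F b"
  using assms unfolding midpoint_convex_def by blast

text \<open>By these identities midpoint convexity restricted to 0/1 vectors is
  submodularity.\<close>

lemma midpoint_ind:
  "(\<lambda>i. (ind S i + ind T i + 1) div 2) = ind (S \<union> T)"
  "(\<lambda>i. (ind S i + ind T i) div 2) = ind (S \<inter> T)"
  by (auto simp: ind_def fun_eq_iff)

text \<open>Let \<open>x\<close> be the first entry of \<open>xs\<close> missing from
  \<open>S\<close>. Submodularity for \<open>S\<close> and the prefix ending in \<open>x\<close>
  gives \<open>F (ind (insert x S)) \<le> F (ind S)\<close>, because \<open>F\<close> vanishes on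
  both prefixes involved. Repeating this fills \<open>S\<close> up to \<open>set xs\<close>, itself
  a prefix.\<close>

lemma midpoint_convex_nonneg_cube:
  fixes xs :: "'a::finite list"
  assumes closed: "midpoint_closed B" and conv: "midpoint_convex B F"
    and chain: "\<And>j. j \<le> length xs \<Longrightarrow> ind (set (take j xs)) \<in> B"
    and zero: "\<And>j. j \<le> length xs \<Longrightarrow> F (ind (set (take j xs))) = 0"
    and S: "S \<subseteq> set xs" "ind S \<in> B"
  shows "F (ind S) \<ge> 0"
  using S
proof (induction "card (set xs - S)" arbitrary: S rule: less_induct)
  case less
  show ?case
  proof (cases "S = set xs")
    case True
    then show ?thesis using zero[of "length xs"] by simp
  next
    case False
    \<comment> \<open>Minimality of \<open>j\<close> puts all earlier entries into \<open>S\<close>,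
      so that \<open>S\<close> meets the prefix of length \<open>Suc j\<close> exactly in the prefix
      of length \<open>j\<close>.\<close>
    define P where "P j \<longleftrightarrow> j < length xs \<and> xs ! j \<notin> S" for j
    obtain i where "i \<in> set xs" "i \<notin> S" using False less.prems(1) by blast
    then have "\<exists>j. P j" by (auto simp: P_def in_set_conv_nth)
    define j where "j = (LEAST j. P j)"
    have j: "j < length xs" "xs ! j \<notin> S"
      using LeastI_ex[OF \<open>\<exists>j. P j\<close>] by (auto simp: j_def P_def)
    have "xs ! k \<in> S" if "k < j" for k
      using not_less_Least[of k P] that j by (auto simp: j_def P_def)
    then have sub: "set (take j xs) \<subseteq> S"
      using j(1) by (auto simp flip: nth_image)
    have Suc: "set (take (Suc j) xs) = insert (xs ! j) (set (take j xs))"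
      using j by (simp add: take_Suc_conv_app_nth)
    have un: "S \<union> set (take (Suc j) xs) = insert (xs ! j) S"
      and int: "S \<inter> set (take (Suc j) xs) = set (take j xs)"
      unfolding Suc using sub j(2) by blast+
    have V: "ind (set (take (Suc j) xs)) \<in> B" using chain j by simp
    have "F (ind (insert (xs ! j) S)) + F (ind (set (take j xs)))
        \<le> F (ind S) + F (ind (set (take (Suc j) xs)))"
      using midpoint_convexD[OF conv less.prems(2) V] by (simp only: midpoint_ind un int)
    moreover have "F (ind (insert (xs ! j) S)) \<ge> 0"
    proof (rule less.hyps)
      show "card (set xs - insert (xs ! j) S) < card (set xs - S)"
        by (rule psubset_card_mono) (use j nth_mem in blast)+
      show "insert (xs ! j) S \<subseteq> set xs" using j less.prems by auto
      show "ind (insert (xs ! j) S) \<in> B"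
        using midpoint_closedD(1)[OF closed less.prems(2) V] by (simp only: midpoint_ind un)
    qed
    ultimately show ?thesis using zero[of j] zero[of "Suc j"] j by simp
  qed
qed

text \<open>
  A point of the box \<open>[-q, 1+p]\<close> is averaged with the bottom vertex if \<open>p > 0\<close> and with the top
  vertex if \<open>q > 0\<close>; both rounded midpoints then lie in a smaller box.
\<close>

lemma midpoint_convex_nonneg:
  fixes xs :: "'a::finite list"
  assumes closed: "midpoint_closed B" and conv: "midpoint_convex B F"
    and chain: "\<And>j. j \<le> length xs \<Longrightarrow> ind (set (take j xs)) \<in> B"
    and zero: "\<And>j. j \<le> length xs \<Longrightarrow> F (ind (set (take j xs))) = 0"
    and supp: "\<forall>a\<in>B. \<forall>i. i \<notin> set xs \<longrightarrow> a i = 0"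
    and y: "y \<in> B"
  shows "F y \<ge> 0"
proof -
  have box: "F y \<ge> 0" if "y \<in> B" "\<And>i. - int q \<le> y i \<and> y i \<le> 1 + int p" for p q y
    using that
  proof (induction "p + q" arbitrary: p q y rule: less_induct)
    case less
    have step: ?case
      if b: "b \<in> B" "F b = 0" and less': "p' + q' < p + q"
        and bnd: "\<And>i. - int q' \<le> (y i + b i) div 2 \<and> (y i + b i + 1) div 2 \<le> 1 + int p'"
      for b p' q'
    proof -
      \<comment> \<open>\<open>bnd\<close> bounds the floor from below and the ceiling from above;
        floor \<le> ceiling supplies the other two bounds.\<close>
      have "- int q' \<le> (y i + b i + 1) div 2 \<and> (y i + b i) div 2 \<le> 1 + int p'" for i
      proof -
        have "(y i + b i) div 2 \<le> (y i + b i + 1) div 2" by (simp add: zdiv_mono1)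
        then show ?thesis using bnd[of i] by linarith
      qed
      then have "F (\<lambda>i. (y i + b i + 1) div 2) \<ge> 0" "F (\<lambda>i. (y i + b i) div 2) \<ge> 0"
        using less.hyps[OF less'] midpoint_closedD[OF closed less.prems(1) b(1)] bnd by auto
      then show ?thesis
        using midpoint_convexD[OF conv less.prems(1) b(1)] b(2) by linarith
    qed
    consider "p > 0" | "q > 0" | "p = 0" "q = 0" by linarith
    then show ?case
    proof cases
      case 1
      have "- int q \<le> (y i + ind {} i) div 2 \<and> (y i + ind {} i + 1) div 2 \<le> 1 + int (p - 1)" for i
        using less.prems(2)[of i] 1 by auto
      then show ?thesis using step[of "ind {}" "p - 1" q] chain[of 0] zero[of 0] 1 by simp
    next
      case 2
      \<comment> \<open>The top vertex is 1 only on \<open>set xs\<close>; elsewhere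
        \<open>supp\<close> makes \<open>y\<close> vanish, so the average is 0 there.\<close>
      have "- int (q - 1) \<le> (y i + ind (set xs) i) div 2
          \<and> (y i + ind (set xs) i + 1) div 2 \<le> 1 + int p" for i
        using less.prems(2)[of i] supp less.prems(1) 2
        by (cases "i \<in> set xs") (auto simp: ind_def)
      then show ?thesis
        using step[of "ind (set xs)" p "q - 1"] chain[of "length xs"] zero[of "length xs"] 2
        by simp
    next
      case 3
      \<comment> \<open>The box has shrunk to the unit cube, so \<open>y\<close> is an indicator and
        the submodular case applies.\<close>
      have "y = ind {i. y i = 1}"
      proof
        fix i
        show "y i = ind {i. y i = 1} i"
          using less.prems(2)[of i] 3 by (auto simp: ind_def)
      qed
      moreover have "{i. y i = 1} \<subseteq> set xs"
        using supp less.prems(1) by fastforce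
      ultimately show ?thesis
        using midpoint_convex_nonneg_cube[OF closed conv chain zero] less.prems(1) by metis
    qed
  qed
  define m where "m = (\<Sum>i\<in>UNIV. nat \<bar>y i\<bar>)"
  have "nat \<bar>y i\<bar> \<le> m" for i
    unfolding m_def by (rule member_le_sum) auto
  then have "- int m \<le> y i \<and> y i \<le> 1 + int m" for i
    by (metis abs_le_iff add.commute add_increasing2 minus_le_iff nat_le_iff zero_le_one)
  then show ?thesis using box y by blast
qed

section \<open>Affine interpolation along a chain\<close>

text \<open>Each prefix adds one new element, so the system for \<open>p\<close> is triangular:
  \<open>p\<close> at an element is the increment of \<open>G\<close> when that element
  joins.\<close>

lemma chain_interpolation:
  fixes G :: "'a set \<Rightarrow> real"
  assumes "distinct xs"
  shows "\<exists>p. \<forall>j\<le>length xs. G (set (take j xs)) = G {} + (\<Sum>i\<in>set (take j xs). p i)"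
  using assms
proof (induction xs rule: rev_induct)
  case Nil
  then show ?case by simp
next
  case (snoc x xs)
  then obtain p where p: "\<And>j. j \<le> length xs \<Longrightarrow>
      G (set (take j xs)) = G {} + (\<Sum>i\<in>set (take j xs). p i)" by auto
  \<comment> \<open>The change at \<open>x\<close> leaves the earlier equations intact, since by
    distinctness \<open>x\<close> occurs in none of them.\<close>
  define p' where "p' = p(x := G (insert x (set xs)) - G (set xs))"
  have eq: "sum p' T = sum p T" if "T \<subseteq> set xs" for T
    using that snoc.prems by (intro sum.cong) (auto simp: p'_def)
  have "G (set (take j (xs @ [x]))) = G {} + (\<Sum>i\<in>set (take j (xs @ [x])). p' i)"
    if "j \<le> length (xs @ [x])" for j
  proof (cases "j \<le> length xs")
    case True
    then show ?thesis using p[of j] eq[of "set (take j xs)"] by (simp add: set_take_subset)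
  next
    case False
    then have "j = Suc (length xs)" using that by simp
    then show ?thesis
      using p[of "length xs"] eq[of "set xs"] snoc.prems by (simp add: p'_def)
  qed
  then show ?case by blast
qed

text \<open>The rounded midpoints of \<open>a\<close> and \<open>b\<close> sum to
  \<open>a + b\<close>, so an affine function satisfies the midpoint inequality with
  equality.\<close>

lemma midpoint_convex_minus_linear:
  fixes p :: "'a::finite \<Rightarrow> real"
  assumes "midpoint_convex B F"
  shows "midpoint_convex B (\<lambda>a. F a - (c + (\<Sum>i\<in>UNIV. p i * a i)))"
  unfolding midpoint_convex_def
proof (intro ballI)
  fix a b assume ab: "a \<in> B" "b \<in> B"
  have "(\<Sum>i\<in>UNIV. p i * ((a i + b i + 1) div 2)) + (\<Sum>i\<in>UNIV. p i * ((a i + b i) div 2))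
      = (\<Sum>i\<in>UNIV. p i * a i) + (\<Sum>i\<in>UNIV. p i * b i)"
    unfolding sum.distrib[symmetric]
  proof (rule sum.cong)
    fix i
    have "(a i + b i + 1) div 2 + (a i + b i) div 2 = a i + b i" by presburger
    then show "p i * ((a i + b i + 1) div 2) + p i * ((a i + b i) div 2) = p i * a i + p i * b i"
      by (metis distrib_left of_int_add)
  qed simp
  then show "F (\<lambda>i. (a i + b i + 1) div 2) - (c + (\<Sum>i\<in>UNIV. p i * ((a i + b i + 1) div 2)))
      + (F (\<lambda>i. (a i + b i) div 2) - (c + (\<Sum>i\<in>UNIV. p i * ((a i + b i) div 2))))
      \<le> F a - (c + (\<Sum>i\<in>UNIV. p i * a i)) + (F b - (c + (\<Sum>i\<in>UNIV. p i * b i)))"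
    using midpoint_convexD[OF assms ab] by linarith
qed

text \<open>Subtracting the interpolating affine function leaves a midpoint-convex function that
  vanishes on the chain, hence is nonnegative by \<open>midpoint_convex_nonneg\<close>.\<close>

lemma midpoint_convex_affine_minorant:
  fixes xs :: "'a::finite list"
  assumes closed: "midpoint_closed B" and conv: "midpoint_convex B F"
    and "distinct xs"
    and chain: "\<And>j. j \<le> length xs \<Longrightarrow> ind (set (take j xs)) \<in> B"
    and supp: "\<forall>a\<in>B. \<forall>i. i \<notin> set xs \<longrightarrow> a i = 0"
  shows "\<exists>(c::real) (p::'a \<Rightarrow> real). (\<forall>a\<in>B. F a \<ge> c + (\<Sum>i\<in>UNIV. p i * a i)) \<and>
    (\<forall>j\<le>length xs. F (ind (set (take j xs))) = c + (\<Sum>i\<in>UNIV. p i * ind (set (take j xs)) i))"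
proof -
  obtain p where p: "\<And>j. j \<le> length xs \<Longrightarrow>
      F (ind (set (take j xs))) = F (ind {}) + (\<Sum>i\<in>set (take j xs). p i)"
    using chain_interpolation[OF \<open>distinct xs\<close>, of "\<lambda>S. F (ind S)"] by auto
  have "(\<Sum>i\<in>UNIV. p i * ind S i) = sum p S" for S
    by (rule sum.mono_neutral_cong_right) (auto simp: ind_def)
  then have touch: "F (ind (set (take j xs)))
      = F (ind {}) + (\<Sum>i\<in>UNIV. p i * ind (set (take j xs)) i)" if "j \<le> length xs" for j
    using p[OF that] by simp
  define G where "G a = F a - (F (ind {}) + (\<Sum>i\<in>UNIV. p i * a i))" for a
  have conv': "midpoint_convex B G"
    unfolding G_def using conv by (rule midpoint_convex_minus_linear)
  have zero: "G (ind (set (take j xs))) = 0" if "j \<le> length xs" for j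
    using touch[OF that] by (simp only: G_def)
  have "G a \<ge> 0" if "a \<in> B" for a
    using chain zero that by (intro midpoint_convex_nonneg[OF closed conv' _ _ supp])
  then have "\<forall>a\<in>B. F a \<ge> F (ind {}) + (\<Sum>i\<in>UNIV. p i * a i)"
    unfolding G_def diff_ge_0_iff_ge by (rule ballI)
  moreover have "\<forall>j\<le>length xs. F (ind (set (take j xs)))
      = F (ind {}) + (\<Sum>i\<in>UNIV. p i * ind (set (take j xs)) i)"
    using touch by (intro allI impI)
  ultimately show ?thesis by (intro exI conjI)
qed

section \<open>Barycentric coordinates in a Freudenthal simplex\<close>

text \<open>The weights are the successive drops of the decreasing sequence 1, the sorted values of
  \<open>\<theta>\<close>, 0. Sorting makes them nonnegative, and tail sums telescope back to
  \<open>\<theta>\<close>.\<close>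

lemma sorted_chain_weights:
  fixes \<theta> :: "'a \<Rightarrow> real"
  assumes "distinct xs" "sorted (map (\<lambda>i. - \<theta> i) xs)"
    and \<theta>: "\<And>i. 0 \<le> \<theta> i" "\<And>i. \<theta> i \<le> 1" and zero: "\<And>i. i \<notin> set xs \<Longrightarrow> \<theta> i = 0"
  obtains c :: "nat \<Rightarrow> real" where "\<forall>j. c j \<ge> 0" "(\<Sum>j\<le>length xs. c j) = 1"
    "\<forall>i. (\<Sum>j\<le>length xs. c j * ind (set (take j xs)) i) = \<theta> i"
proof -
  \<comment> \<open>The shift by one aligns \<open>c j\<close> with the prefix of length
    \<open>j\<close>: \<open>t 0 = 1\<close> makes the weights sum to 1, and the final 0 closes the
    telescope.\<close>
  define t where "t j = (case j of 0 \<Rightarrow> 1 | Suc k \<Rightarrow> if k < length xs then \<theta> (xs ! k) else 0)" for j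
  define c where "c j = t j - t (Suc j)" for j
  show thesis
  proof
    have "c j \<ge> 0" for j
    proof (cases j)
      case 0
      then show ?thesis using \<theta> by (simp add: c_def t_def)
    next
      case (Suc k)
      then show ?thesis
        using \<theta> sorted_nth_mono[OF assms(2), of k "Suc k"] by (auto simp: c_def t_def)
    qed
    then show "\<forall>j. c j \<ge> 0" ..
    have tel: "(\<Sum>j = q..length xs. c j) = t q" if "q \<le> length xs" for q
    proof -
      have "(\<Sum>j = q..length xs. c j) = - (\<Sum>j = q..length xs. t (Suc j) - t j)"
        by (simp add: c_def sum_negf[symmetric])
      also have "\<dots> = t q - t (Suc (length xs))"
        using that by (subst sum_Suc_diff) auto
      finally show ?thesis by (simp add: t_def)
    qed
    show "(\<Sum>j\<le>length xs. c j) = 1"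
      using tel[of 0] by (simp add: t_def atMost_atLeast0)
    have "(\<Sum>j\<le>length xs. c j * ind (set (take j xs)) i) = \<theta> i" for i
    proof (cases "i \<in> set xs")
      case True
      then obtain q where q: "q < length xs" "i = xs ! q" by (metis in_set_conv_nth)
      \<comment> \<open>Exactly the prefixes longer than \<open>q\<close> contain
        \<open>xs ! q\<close>, so its coordinate is the tail sum from \<open>Suc q\<close>, which is
        \<open>t (Suc q) = \<theta> (xs ! q)\<close>.\<close>
      have mem: "i \<in> set (take j xs) \<longleftrightarrow> q < j" if "j \<le> length xs" for j
        using q that \<open>distinct xs\<close> by (auto simp: in_set_conv_nth nth_eq_iff_index_eq)
      have "(\<Sum>j\<le>length xs. c j * ind (set (take j xs)) i) = (\<Sum>j = Suc q..length xs. c j)"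
        by (rule sum.mono_neutral_cong_right) (auto simp: ind_def mem)
      then show ?thesis using tel[of "Suc q"] q by (simp add: t_def)
    next
      case False
      then have "ind (set (take j xs)) i = 0" for j
        by (meson in_set_takeD ind_def)
      then show ?thesis using zero[OF False] by simp
    qed
    then show "\<forall>i. (\<Sum>j\<le>length xs. c j * ind (set (take j xs)) i) = \<theta> i" ..
  qed
qed

section \<open>Lattice points as integer offsets\<close>

text \<open>Measuring from a base point \<open>z\<close> turns the vertices of a Freudenthal simplex
  into indicators of prefixes, with \<open>ind {}\<close> at \<open>z\<close> itself.\<close>

definition lattice_pt :: "('n \<Rightarrow> int) \<Rightarrow> ('n \<Rightarrow> int) \<Rightarrow> real ^ 'n::finite" where
  "lattice_pt z a = (\<chi> i. real_of_int (z i + a i))"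

lemma lattice_pt_midpoint:
  "vec_ceiling ((1/2) *\<^sub>R (lattice_pt z a + lattice_pt z b)) = lattice_pt z (\<lambda>i. (a i + b i + 1) div 2)"
  "vec_floor ((1/2) *\<^sub>R (lattice_pt z a + lattice_pt z b)) = lattice_pt z (\<lambda>i. (a i + b i) div 2)"
proof -
  have fl: "\<lfloor>(real_of_int (z i + a i) + real_of_int (z i + b i)) / 2\<rfloor> = z i + (a i + b i) div 2" for i
  proof -
    have "\<lfloor>(real_of_int (z i + a i) + real_of_int (z i + b i)) / 2\<rfloor> = (z i + a i + (z i + b i)) div 2"
      by (metis floor_divide_of_int_eq of_int_add of_int_numeral)
    then show ?thesis by presburger
  qed
  have ce: "\<lceil>(real_of_int (z i + a i) + real_of_int (z i + b i)) / 2\<rceil> = z i + (a i + b i + 1) div 2" for i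
  proof -
    have "\<lceil>(real_of_int (z i + a i) + real_of_int (z i + b i)) / 2\<rceil> = - ((- (z i + a i + (z i + b i))) div 2)"
      by (metis ceiling_divide_eq_div of_int_add of_int_numeral)
    then show ?thesis by presburger
  qed
  show "vec_ceiling ((1/2) *\<^sub>R (lattice_pt z a + lattice_pt z b)) = lattice_pt z (\<lambda>i. (a i + b i + 1) div 2)"
    using ce by (simp add: vec_ceiling_def lattice_pt_def vec_eq_iff)
  show "vec_floor ((1/2) *\<^sub>R (lattice_pt z a + lattice_pt z b)) = lattice_pt z (\<lambda>i. (a i + b i) div 2)"
    using fl by (simp add: vec_floor_def lattice_pt_def vec_eq_iff)
qed

lemma lattice_pt_in_hyperrect_iff:
  "lattice_pt z a \<in> discrete_hyperrect l u \<longleftrightarrow>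
     (\<forall>i. l i \<le> ereal (z i + a i) \<and> ereal (z i + a i) \<le> u i)"
  by (simp add: lattice_pt_def discrete_hyperrect_def)

lemma discrete_hyperrect_latticeE:
  assumes "y \<in> discrete_hyperrect l u"
  obtains a where "y = lattice_pt z a"
proof
  show "y = lattice_pt z (\<lambda>i. \<lfloor>y $ i\<rfloor> - z i)"
    using assms by (simp add: discrete_hyperrect_def lattice_pt_def vec_eq_iff)
qed

text \<open>In each coordinate both rounded midpoints lie between the two given integers, hence
  within the same bounds.\<close>

lemma midpoint_closed_hyperrect:
  "midpoint_closed {a. lattice_pt z a \<in> discrete_hyperrect l u}"
  unfolding midpoint_closed_def lattice_pt_in_hyperrect_iff
proof (intro ballI conjI CollectI allI)
  fix a b i
  assume "a \<in> {a. \<forall>i. l i \<le> ereal (z i + a i) \<and> ereal (z i + a i) \<le> u i}"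
    "b \<in> {a. \<forall>i. l i \<le> ereal (z i + a i) \<and> ereal (z i + a i) \<le> u i}"
  then have ab: "l i \<le> ereal (z i + a i)" "ereal (z i + a i) \<le> u i"
    "l i \<le> ereal (z i + b i)" "ereal (z i + b i) \<le> u i"
    by auto
  have mono: "ereal (z i + c) \<le> ereal (z i + d)" if "c \<le> d" for c d :: int
    using that by simp
  have between: "l i \<le> ereal (z i + k)" "ereal (z i + k) \<le> u i"
    if "a i \<le> k \<or> b i \<le> k" "k \<le> a i \<or> k \<le> b i" for k
    using that ab mono by (meson order_trans)+
  show "l i \<le> ereal (z i + (a i + b i + 1) div 2)" "ereal (z i + (a i + b i + 1) div 2) \<le> u i"
    "l i \<le> ereal (z i + (a i + b i) div 2)" "ereal (z i + (a i + b i) div 2) \<le> u i"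
    by (rule between; linarith)+
qed

lemma midpoint_convex_L_natural:
  assumes "L_natural_convex_on X f"
  shows "midpoint_convex {a. lattice_pt z a \<in> X} (\<lambda>a. f (lattice_pt z a))"
  using assms by (auto simp: L_natural_convex_on_def midpoint_convex_def lattice_pt_midpoint[symmetric])

section \<open>Lower bounds on envelopes and common weights\<close>

text \<open>The half-space above an affine minorant is convex and contains the epigraph, hence also
  its hull.\<close>

lemma hull_epi_ge_affine:
  fixes x p :: "real ^ 'n::finite"
  assumes minor: "\<And>y. y \<in> X \<Longrightarrow> c + p \<bullet> y \<le> f y" and "(w, x) \<in> convex hull (epi X f)"
  shows "c + p \<bullet> x \<le> w"
proof -
  have "convex {q :: real \<times> (real ^ 'n). (1, - p) \<bullet> q \<ge> c}"
    by (rule convex_halfspace_ge)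
  moreover have "epi X f \<subseteq> {q. (1, - p) \<bullet> q \<ge> c}"
    using minor by (force simp: epi_def)
  ultimately have "convex hull (epi X f) \<subseteq> {q. (1, - p) \<bullet> q \<ge> c}"
    by (rule hull_minimal[rotated])
  then show ?thesis using assms(2) by auto
qed

text \<open>
  The base point may have to be \<open>u j - 1\<close> instead of the floor of \<open>x j\<close>, so that the whole unit cube
  in the non-degenerate directions stays in the hyperrectangle.
\<close>

lemma unit_cell:
  assumes "l \<in> int_or_minf" "u \<in> int_or_pinf" "l \<le> ereal x" "ereal x \<le> u"
  obtains z :: int where "real_of_int z \<le> x" "x \<le> z + 1" "l \<le> ereal z" "ereal z \<le> u"
    "l \<noteq> u \<Longrightarrow> ereal (z + 1) \<le> u" "l = u \<Longrightarrow> x = z"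
proof (cases "ereal x = u")
  case True
  then obtain k :: int where k: "u = ereal k" "x = k"
    using assms(2) by (auto simp: int_or_pinf_def)
  show thesis
  proof (cases "l = u")
    case True
    then show thesis using that[of k] k by auto
  next
    case False
    \<comment> \<open>Integrality turns \<open>l < k\<close> into \<open>l \<le> k - 1\<close>; the
      value \<open>-\<infinity>\<close> is harmless.\<close>
    then have "l \<le> ereal (k - 1)"
      using assms(1,3) k by (auto simp: int_or_minf_def simp flip: of_int_diff)
    then show thesis using that[of "k - 1"] k False by auto
  qed
next
  case False
  have "l \<le> ereal \<lfloor>x\<rfloor>"
    using assms(1,3) by (auto simp: int_or_minf_def le_floor_iff)
  moreover have "ereal (\<lfloor>x\<rfloor> + 1) \<le> u"
  proof (cases u)
    case (real r)
    then obtain k :: int where k: "u = ereal k" using assms(2) by (auto simp: int_or_pinf_def)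
    then have "x < k" using False assms(4) by auto
    then have "\<lfloor>x\<rfloor> + 1 \<le> k" by linarith
    then show ?thesis using k by (metis ereal_less_eq(3) of_int_1 of_int_add of_int_le_iff)
  qed (use assms(4) in auto)
  moreover have "ereal \<lfloor>x\<rfloor> \<le> u"
    using assms(4) by (meson ereal_less_eq(3) of_int_floor_le order_trans)
  moreover have "l \<noteq> u" using False assms(3,4) by auto
  moreover have "real_of_int \<lfloor>x\<rfloor> \<le> x" "x \<le> real_of_int \<lfloor>x\<rfloor> + 1" by linarith+
  ultimately show thesis using that[of "\<lfloor>x\<rfloor>"] by auto
qed

text \<open>The weights and vertices are fixed before \<open>f\<close> and \<open>w\<close> are
  quantified, so one combination serves all \<open>f i\<close> and \<open>g i\<close> at
  once.\<close>

lemma common_envelope_weights: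
  fixes x :: "real ^ 'n::finite"
  assumes l: "\<And>j. l j \<in> int_or_minf" and u: "\<And>j. u j \<in> int_or_pinf"
    and X: "X = discrete_hyperrect l u" and x: "x \<in> hyperrect l u"
  obtains m :: nat and c :: "nat \<Rightarrow> real" and v where
    "\<forall>j. c j \<ge> 0" "(\<Sum>j\<le>m. c j) = 1" "\<forall>j\<le>m. v j \<in> X" "(\<Sum>j\<le>m. c j *\<^sub>R v j) = x"
    "\<forall>f w. L_natural_convex_on X f \<longrightarrow> (w, x) \<in> convex hull (epi X f) \<longrightarrow>
       (\<Sum>j\<le>m. c j * f (v j)) \<le> w"
proof -
  have "\<exists>z::int. real_of_int z \<le> x $ i \<and> x $ i \<le> z + 1 \<and> l i \<le> ereal z \<and> ereal z \<le> u i \<and>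
      (l i \<noteq> u i \<longrightarrow> ereal (z + 1) \<le> u i) \<and> (l i = u i \<longrightarrow> x $ i = z)" for i
    by (rule unit_cell[OF l[of i] u[of i], of "x $ i"]) (use x in \<open>auto simp: hyperrect_def\<close>)
  then obtain z :: "'n \<Rightarrow> int" where z: "\<And>i. real_of_int (z i) \<le> x $ i" "\<And>i. x $ i \<le> z i + 1"
    "\<And>i. l i \<le> ereal (z i)" "\<And>i. ereal (z i) \<le> u i"
    "\<And>i. l i \<noteq> u i \<Longrightarrow> ereal (z i + 1) \<le> u i" "\<And>i. l i = u i \<Longrightarrow> x $ i = z i"
    by metis
  define \<theta> where "\<theta> i = x $ i - z i" for i
  \<comment> \<open>Only directions with \<open>l i \<noteq> u i\<close> have room for a unit step
    from \<open>z\<close>.\<close>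
  obtain ys where ys: "set ys = {i. l i \<noteq> u i}" "distinct ys"
    using finite_distinct_list[of "{i. l i \<noteq> u i}"] by auto
  \<comment> \<open>Listing the fractional parts in decreasing order selects the Freudenthal simplex
    that contains \<open>x\<close>.\<close>
  define xs where "xs = sort_key (\<lambda>i. - \<theta> i) ys"
  have xs: "set xs = {i. l i \<noteq> u i}" "distinct xs" "sorted (map (\<lambda>i. - \<theta> i) xs)"
    using ys by (simp_all add: xs_def)
  define v where "v j = lattice_pt z (ind (set (take j xs)))" for j
  define B where "B = {a. lattice_pt z a \<in> X}"
  have chain: "ind (set (take j xs)) \<in> B" for j
  proof -
    have "l i \<le> ereal (z i + ind (set (take j xs)) i) \<and> ereal (z i + ind (set (take j xs)) i) \<le> u i" for i
    proof (cases "i \<in> set (take j xs)")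
      case True
      then have "l i \<noteq> u i" using xs(1) in_set_takeD by fastforce
      moreover have "l i \<le> ereal (z i + 1)" using z(3)[of i] by (rule order_trans) simp
      ultimately show ?thesis using True z(5) by (simp add: ind_def)
    next
      case False
      then show ?thesis using z(3,4) by (simp add: ind_def)
    qed
    then show ?thesis by (simp add: B_def X lattice_pt_in_hyperrect_iff)
  qed
  have supp: "\<forall>a\<in>B. \<forall>i. i \<notin> set xs \<longrightarrow> a i = 0"
  proof (intro ballI allI impI)
    fix a i assume "a \<in> B" "i \<notin> set xs"
    then have "l i \<le> ereal (z i + a i)" "ereal (z i + a i) \<le> u i"
      unfolding B_def X lattice_pt_in_hyperrect_iff by blast+
    moreover have eq: "u i = l i" using \<open>i \<notin> set xs\<close> xs(1) by simp
    ultimately have "ereal (z i + a i) = ereal (z i)"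
      using z(3,4)[of i] unfolding eq by (metis antisym)
    then show "a i = 0" by simp
  qed
  have \<theta>: "0 \<le> \<theta> i" "\<theta> i \<le> 1" "i \<notin> set xs \<Longrightarrow> \<theta> i = 0" for i
    using z(1,2,6)[of i] xs by (auto simp: \<theta>_def)
  obtain c :: "nat \<Rightarrow> real" where c: "\<forall>j. c j \<ge> 0" "(\<Sum>j\<le>length xs. c j) = 1"
    "\<forall>i. (\<Sum>j\<le>length xs. c j * ind (set (take j xs)) i) = \<theta> i"
    by (rule sorted_chain_weights[OF xs(2,3) \<theta>])
  have cx: "(\<Sum>j\<le>length xs. c j *\<^sub>R v j) = x"
  proof (rule vec_eq_iff[THEN iffD2], rule allI)
    fix i
    have "(\<Sum>j\<le>length xs. c j *\<^sub>R v j) $ i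
        = z i * (\<Sum>j\<le>length xs. c j) + (\<Sum>j\<le>length xs. c j * ind (set (take j xs)) i)"
      by (simp add: v_def lattice_pt_def algebra_simps sum.distrib sum_distrib_left)
    then show "(\<Sum>j\<le>length xs. c j *\<^sub>R v j) $ i = x $ i"
      using c(2,3) by (simp add: \<theta>_def)
  qed
  show thesis
  proof (rule that[of c "length xs" v, OF c(1,2) _ cx]; intro allI impI)
    show "v j \<in> X" for j using chain by (simp add: v_def B_def)
    fix f w
    assume f: "L_natural_convex_on X f" and w: "(w, x) \<in> convex hull (epi X f)"
    have closed: "midpoint_closed B" unfolding B_def X by (rule midpoint_closed_hyperrect)
    have conv: "midpoint_convex B (\<lambda>a. f (lattice_pt z a))"
      unfolding B_def using f by (rule midpoint_convex_L_natural)
    obtain d :: real and p :: "'n \<Rightarrow> real" where dp: "\<And>a. a \<in> B \<Longrightarrow> f (lattice_pt z a) \<ge> d + (\<Sum>i\<in>UNIV. p i * a i)"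
      "\<And>j. j \<le> length xs \<Longrightarrow> f (v j) = d + (\<Sum>i\<in>UNIV. p i * ind (set (take j xs)) i)"
      using midpoint_convex_affine_minorant[OF closed conv xs(2) chain supp] unfolding v_def by blast
    \<comment> \<open>\<open>q\<close> and \<open>e\<close> rewrite the affine function of the
      offset \<open>a\<close> as one of the point \<open>z + a\<close>.\<close>
    define q :: "real ^ 'n" where "q = (\<chi> i. p i)"
    define e where "e = d - (\<Sum>i\<in>UNIV. p i * z i)"
    have aff: "e + q \<bullet> lattice_pt z a = d + (\<Sum>i\<in>UNIV. p i * a i)" for a
      by (simp add: e_def q_def lattice_pt_def inner_vec_def algebra_simps sum.distrib)
    have "e + q \<bullet> y \<le> f y" if y: "y \<in> X" for y
    proof -
      obtain a where "y = lattice_pt z a" by (rule discrete_hyperrect_latticeE[OF y[unfolded X]])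
      then show ?thesis using dp(1)[of a] aff y by (simp add: B_def)
    qed
    then have "e + q \<bullet> x \<le> w" using hull_epi_ge_affine w by blast
    \<comment> \<open>At every \<open>v j\<close> the function equals its affine minorant, and
      affine functions commute with convex combinations.\<close>
    moreover have "(\<Sum>j\<le>length xs. c j * f (v j)) = (\<Sum>j\<le>length xs. c j * (e + q \<bullet> v j))"
      using dp(2) aff by (intro sum.cong) (auto simp: v_def)
    moreover have "\<dots> = e + q \<bullet> x"
      using c(2) by (simp add: cx[symmetric] inner_sum_right distrib_left sum.distrib
          sum_distrib_right[symmetric])
    ultimately show "(\<Sum>j\<le>length xs. c j * f (v j)) \<le> w" by simp
  qed
qed

section \<open>The two inclusions\<close>

lemma convex_hyperrect: "convex (hyperrect l u)"
proof -
  have "convex {r. l i \<le> ereal r \<and> ereal r \<le> u i}" for i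
  proof (rule is_interval_convex, unfold is_interval_1, clarify)
    fix a b r assume "l i \<le> ereal a" "ereal b \<le> u i" "a \<le> r" "r \<le> b"
    then show "l i \<le> ereal r \<and> ereal r \<le> u i" by (meson ereal_less_eq(3) order_trans)
  qed
  then have "convex (\<Inter>i. (\<lambda>x. x $ i) -` {r. l i \<le> ereal r \<and> ereal r \<le> u i})"
    by (intro convex_INT convex_linear_vimage linear_componentwise)
      (auto intro: bounded_linear.linear bounded_linear_vec_nth)
  then show ?thesis by (simp add: hyperrect_def vimage_def Collect_all_eq)
qed

text \<open>Hull membership is a convex condition, and the equalities of differences are linear in
  the point.\<close>

lemma convex_CQ':
  assumes "convex Xbar"
  shows "convex (CQ' X Xbar f g)"
proof (rule convexI)
  fix a b and s t :: real
  assume ab: "a \<in> CQ' X Xbar f g" "b \<in> CQ' X Xbar f g" and st: "0 \<le> s" "0 \<le> t" "s + t = 1"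
  obtain \<eta> w x \<eta>' w' x' where eq: "a = (\<eta>, w, x)" "b = (\<eta>', w', x')" by (metis prod.exhaust)
  have hull: "(s * r + t * r', s *\<^sub>R x + t *\<^sub>R x') \<in> convex hull S"
    if "(r, x) \<in> convex hull S" "(r', x') \<in> convex hull S" for r r' S
    using convexD[OF convex_convex_hull that st] by simp
  have diff: "s * \<eta> $ i + t * \<eta>' $ i - (s * w $ i + t * w' $ i)
      = s * (\<eta> $ i - w $ i) + t * (\<eta>' $ i - w' $ i)" for i
    by (simp add: algebra_simps)
  have "\<eta> $ i - w $ i = \<eta> $ i' - w $ i'" "\<eta>' $ i - w' $ i = \<eta>' $ i' - w' $ i'" for i i'
    using ab by (auto simp: CQ'_def eq)
  then have "s * \<eta> $ i + t * \<eta>' $ i - (s * w $ i + t * w' $ i)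
      = s * \<eta> $ i' + t * \<eta>' $ i' - (s * w $ i' + t * w' $ i')" for i i'
    unfolding diff by metis
  moreover have "s *\<^sub>R x + t *\<^sub>R x' \<in> Xbar"
    using ab convexD[OF assms _ _ st] by (simp add: CQ'_def eq)
  ultimately show "s *\<^sub>R a + t *\<^sub>R b \<in> CQ' X Xbar f g"
    using ab hull by (simp add: CQ'_def eq)
qed

lemma Q'_subset_CQ':
  assumes "X \<subseteq> Xbar"
  shows "Q' X f g \<subseteq> CQ' X Xbar f g"
  using assms by (auto simp: Q'_def CQ'_def epi_def intro!: hull_inc)

theorem proposition4p3:
  fixes l u :: "'n::finite \<Rightarrow> ereal"
    and f g :: "'k::finite \<Rightarrow> real ^ 'n \<Rightarrow> real"
    and X Xbar :: "(real ^ 'n) set"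
  assumes l: "\<And>j. l j \<in> int_or_minf"
    and u: "\<And>j. u j \<in> int_or_pinf"
    and X: "X = discrete_hyperrect l u"
    and Xbar: "Xbar = hyperrect l u"
    and f: "\<And>i. L_natural_convex_on X (f i)"
    and g: "\<And>i. L_natural_convex_on X (g i)"
    and h: "\<exists>h :: real ^ 'n \<Rightarrow> real. \<forall>x\<in>X. \<forall>i. h x = g i x - f i x"
  shows "convex hull (Q' X f g) = CQ' X Xbar f g"
proof
  have "X \<subseteq> Xbar" by (auto simp: X Xbar discrete_hyperrect_def hyperrect_def)
  then show "convex hull (Q' X f g) \<subseteq> CQ' X Xbar f g"
    by (intro hull_minimal Q'_subset_CQ' convex_CQ') (simp_all add: Xbar convex_hyperrect)
next
  show "CQ' X Xbar f g \<subseteq> convex hull (Q' X f g)"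
  proof (rule subsetI)
    fix q assume q: "q \<in> CQ' X Xbar f g"
    obtain \<eta> w x where q_eq: "q = (\<eta>, w, x)" by (metis prod.exhaust)
    have xbar: "x \<in> hyperrect l u"
      and \<eta>: "\<And>i. (\<eta> $ i, x) \<in> convex hull (epi X (g i))"
      and w: "\<And>i. (w $ i, x) \<in> convex hull (epi X (f i))"
      and diff: "\<And>i i'. \<eta> $ i - w $ i = \<eta> $ i' - w $ i'"
      using q by (auto simp: q_eq CQ'_def Xbar)
    obtain h where h: "\<And>x i. x \<in> X \<Longrightarrow> h x = g i x - f i x"
      using \<open>\<exists>h. \<forall>x\<in>X. \<forall>i. h x = g i x - f i x\<close> by blast
    obtain m :: nat and c v where c: "\<forall>j. c j \<ge> 0" "(\<Sum>j\<le>m. c j) = 1"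
      and v: "\<forall>j\<le>m. v j \<in> X" and cx: "(\<Sum>j\<le>m. c j *\<^sub>R v j) = x"
      and env: "\<forall>f w. L_natural_convex_on X f \<longrightarrow> (w, x) \<in> convex hull (epi X f) \<longrightarrow>
        (\<Sum>j\<le>m. c j * f (v j)) \<le> w"
      by (rule common_envelope_weights[OF l u X xbar])
    define s where "s i = w $ i - (\<Sum>j\<le>m. c j * f i (v j))" for i
    define t where "t i = \<eta> $ i - (\<Sum>j\<le>m. c j * g i (v j))" for i
    have s: "s i \<ge> 0" and t: "t i \<ge> 0" for i
      using env f w g \<eta> by (simp_all add: s_def t_def)
    \<comment> \<open>Neither \<open>\<eta> $ i - w $ i\<close> nor the sum over \<open>h\<close>
      varies with \<open>i\<close>, so \<open>t i - s i\<close> does not either.\<close>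
    have ts: "t i - s i = \<eta> $ i - w $ i - (\<Sum>j\<le>m. c j * h (v j))" for i
    proof -
      have "(\<Sum>j\<le>m. c j * h (v j)) = (\<Sum>j\<le>m. c j * g i (v j) - c j * f i (v j))"
        using v by (intro sum.cong) (auto simp: h[where i = i] right_diff_distrib)
      then show ?thesis by (simp add: s_def t_def sum_subtractf)
    qed
    \<comment> \<open>The slacks are the same at every vertex; this keeps \<open>\<eta> - w\<close>
      constant across indices within each \<open>P j\<close>.\<close>
    define P where "P j = ((\<chi> i. g i (v j) + t i) :: real ^ 'k, (\<chi> i. f i (v j) + s i) :: real ^ 'k, v j)" for j
    have "P j \<in> Q' X f g" if "j \<le> m" for j
    proof -
      have vj: "v j \<in> X" using v that by blast
      have "g i (v j) + t i - (f i (v j) + s i) = g i' (v j) + t i' - (f i' (v j) + s i')" for i i'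
        using ts[of i] ts[of i'] diff[of i i'] h[OF vj, of i] h[OF vj, of i'] by linarith
      then show ?thesis using vj s t by (simp add: P_def Q'_def)
    qed
    then have "(\<Sum>j\<le>m. c j *\<^sub>R P j) \<in> convex hull (Q' X f g)"
      using c by (intro convex_sum convex_convex_hull) (auto intro: hull_inc)
    moreover have "(\<Sum>j\<le>m. c j *\<^sub>R P j) = q"
    proof -
      \<comment> \<open>As the weights sum to 1, averaging returns each slack once, which restores
        \<open>w\<close> and \<open>\<eta>\<close> exactly.\<close>
      have "(\<Sum>j\<le>m. c j * (F j + r)) = (\<Sum>j\<le>m. c j * F j) + r" for F r
        by (simp add: distrib_left sum.distrib sum_distrib_right[symmetric] c(2))
      then show ?thesis
        by (simp add: q_eq P_def prod_eq_iff fst_sum snd_sum cx vec_eq_iff s_def t_def)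
    qed
    ultimately show "q \<in> convex hull (Q' X f g)" by simp
  qed
qed

end
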